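(* Let $\Omega\subset\mathbb{H}_1$ be a domain and let $f=(f_1,f_2,f_3)=(Xu,Yu,Tu)$ be the gradient harmonic map given by a harmonic function $u:\Omega\to\mathbb{R}$. Then $$\Delta_Hf_1=8Tf_2,\qquad\Delta_Hf_2=-8Tf_1,\qquad\Delta_Hf_3=0 .$$ In particular, $\Delta_HF=-8i\,TF$ for $F=f_1+if_2$. Moreover, $f$ satisfies the system $$\Delta_H(\Delta_Hf_1)=-64T^2f_1,\qquad\Delta_H(\Delta_Hf_2)=-64T^2f_2,\qquad\Delta_Hf_3=0 .$$
   Context: The Heisenberg group $\mathbb{H}_1$ is $\mathbb{C}\times\mathbb{R}$ with coordinates $(x+iy,t)$ and product $(z_1,t_1)(z_2,t_2)=(z_1+z_2,\,t_1+t_2+2\,\mathrm{Im}(z_1\bar z_2))$. Put $X=\partial_x+2y\,\partial_t$, $Y=\partial_y-2x\,\partial_t$, $T=\partial_t$ (so $[X,Y]=-4T$), $\Delta_H=X^2+Y^2$. A function $u:\Omega\to\mathbb{R}$ is harmonic if $\Delta_Hu=0$; harmonic functions are known to be real analytic. Given harmonic $u$, the map $f=(Xu,Yu,Tu):\Omega\to\mathbb{H}_1$ is called a gradient harmonic mapping. *)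

theory Defs
  imports "HOL-Analysis.Analysis"
begin

text \<open>
  Points of the Heisenberg group are written \<open>(z, t)\<close> with \<open>z = x + \<i> y\<close>. Its topology is that of
  \<open>\<complex> \<times> \<real>\<close>. The operators below are polymorphic in the codomain so that they apply to real
  functions as well as to the complex function \<open>F = f\<^sub>1 + \<i> f\<^sub>2\<close>. They are total; on an open set
  only the values of the function on that set matter.
\<close>

type_synonym heis = "complex \<times> real"

definition heis_mult :: "heis \<Rightarrow> heis \<Rightarrow> heis" where
  "heis_mult p q = (fst p + fst q, snd p + snd q + 2 * Im (fst p * cnj (fst q)))"

definition partial_x :: "(heis \<Rightarrow> 'a::real_normed_vector) \<Rightarrow> heis \<Rightarrow> 'a" where
  "partial_x u p = vector_derivative (\<lambda>s. u (fst p + of_real s, snd p)) (at 0)"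

definition partial_y :: "(heis \<Rightarrow> 'a::real_normed_vector) \<Rightarrow> heis \<Rightarrow> 'a" where
  "partial_y u p = vector_derivative (\<lambda>s. u (fst p + \<i> * of_real s, snd p)) (at 0)"

definition partial_t :: "(heis \<Rightarrow> 'a::real_normed_vector) \<Rightarrow> heis \<Rightarrow> 'a" where
  "partial_t u p = vector_derivative (\<lambda>s. u (fst p, snd p + s)) (at 0)"

definition heis_X :: "(heis \<Rightarrow> 'a::real_normed_vector) \<Rightarrow> heis \<Rightarrow> 'a" where
  "heis_X u p = partial_x u p + (2 * Im (fst p)) *\<^sub>R partial_t u p"

definition heis_Y :: "(heis \<Rightarrow> 'a::real_normed_vector) \<Rightarrow> heis \<Rightarrow> 'a" where
  "heis_Y u p = partial_y u p - (2 * Re (fst p)) *\<^sub>R partial_t u p"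

definition heis_T :: "(heis \<Rightarrow> 'a::real_normed_vector) \<Rightarrow> heis \<Rightarrow> 'a" where
  "heis_T u = partial_t u"

definition heis_laplacian :: "(heis \<Rightarrow> 'a::real_normed_vector) \<Rightarrow> heis \<Rightarrow> 'a" where
  "heis_laplacian u p = heis_X (heis_X u) p + heis_Y (heis_Y u) p"

text \<open>\<open>C\<^sup>k\<close> functions on an open set.\<close>

primrec Ck_on :: "nat \<Rightarrow> 'a::real_normed_vector set \<Rightarrow> ('a \<Rightarrow> 'b::real_normed_vector) \<Rightarrow> bool" where
  "Ck_on 0 S f \<longleftrightarrow> continuous_on S f"
| "Ck_on (Suc k) S f \<longleftrightarrow>
     (\<forall>p\<in>S. f differentiable (at p)) \<and> (\<forall>v. Ck_on k S (\<lambda>p. frechet_derivative f (at p) v))"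

definition Cinf_on :: "'a::real_normed_vector set \<Rightarrow> ('a \<Rightarrow> 'b::real_normed_vector) \<Rightarrow> bool" where
  "Cinf_on S f \<longleftrightarrow> (\<forall>k. Ck_on k S f)"

text \<open>
  Solutions of \<open>\<Delta>\<^sub>H u = 0\<close> are real analytic (hypoellipticity), in particular smooth, so requiring
  \<open>C\<^sup>\<infinity>\<close> excludes no harmonic function. It makes all the pointwise derivatives genuine.
\<close>

definition heis_harmonic_on :: "heis set \<Rightarrow> (heis \<Rightarrow> real) \<Rightarrow> bool" where
  "heis_harmonic_on \<Omega> u \<longleftrightarrow> Cinf_on \<Omega> u \<and> (\<forall>p\<in>\<Omega>. heis_laplacian u p = 0)"

definition gradient_harmonic_map_on ::
    "heis set \<Rightarrow> (heis \<Rightarrow> real) \<Rightarrow> (heis \<Rightarrow> heis) \<Rightarrow> bool" where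
  "gradient_harmonic_map_on \<Omega> u f \<longleftrightarrow> heis_harmonic_on \<Omega> u \<and>
     (\<forall>p\<in>\<Omega>. f p = (Complex (heis_X u p) (heis_Y u p), heis_T u p))"

text \<open>
  The fields \<open>X\<close>, \<open>Y\<close>, \<open>T\<close> are the left-invariant ones: they differentiate along the right
  translations by the three coordinate axes.
\<close>

lemma heis_right_translations:
  "heis_mult p (of_real s, 0) = (fst p + of_real s, snd p + s * (2 * Im (fst p)))"
  "heis_mult p (\<i> * of_real s, 0) = (fst p + \<i> * of_real s, snd p - s * (2 * Re (fst p)))"
  "heis_mult p (0, s) = (fst p, snd p + s)"
  by (simp_all add: heis_mult_def)

end

theory Submission
  imports Defs
begin

text \<open>
  The commutator relations \<open>[X, Y] = -4T\<close> and \<open>[X, T] = [Y, T] = 0\<close>, valid on smooth real functions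
  by the symmetry of second derivatives, give
  \<open>\<Delta>\<^sub>H X = X \<Delta>\<^sub>H + 8 T Y\<close>, \<open>\<Delta>\<^sub>H Y = Y \<Delta>\<^sub>H - 8 T X\<close> and \<open>\<Delta>\<^sub>H T = T \<Delta>\<^sub>H\<close>. Applied to a harmonic \<open>u\<close>
  this is the first system; applying \<open>\<Delta>\<^sub>H\<close> once more, and moving it past \<open>T\<close>, gives the fourth order one.
\<close>

section \<open>Smooth functions\<close>

text \<open>The direction comes first so that \<open>dir_deriv v f\<close> is again a function of
  the point. It can then be iterated, and it is exactly the operation in the recursion of
  \<open>Ck_on\<close>.\<close>

abbreviation dir_deriv ::
    "'a::real_normed_vector \<Rightarrow> ('a \<Rightarrow> 'b::real_normed_vector) \<Rightarrow> 'a \<Rightarrow> 'b" where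
  "dir_deriv v f \<equiv> \<lambda>p. frechet_derivative f (at p) v"

lemma Cinf_on_differentiable: "Cinf_on S f \<Longrightarrow> p \<in> S \<Longrightarrow> f differentiable (at p)"
  unfolding Cinf_on_def by (metis Ck_on.simps(2))

lemma Cinf_on_dir_deriv: "Cinf_on S f \<Longrightarrow> Cinf_on S (dir_deriv v f)"
  unfolding Cinf_on_def by (metis Ck_on.simps(2))

lemma Cinf_on_has_derivative:
  "Cinf_on S f \<Longrightarrow> p \<in> S \<Longrightarrow> (f has_derivative frechet_derivative f (at p)) (at p)"
  using Cinf_on_differentiable frechet_derivative_works by blast

lemma Cinf_on_continuous: "Cinf_on S f \<Longrightarrow> continuous_on S f"
  unfolding Cinf_on_def by (metis Ck_on.simps(1))

text \<open>Smoothness is treated as a greatest fixed point. A closure property then only needs a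
  class \<open>P\<close> that is stable under directional derivatives, with no counting of the order
  \<open>k\<close>.\<close>

lemma Cinf_on_coinduct:
  assumes P: "P f"
    and diff: "\<And>f p. P f \<Longrightarrow> p \<in> S \<Longrightarrow> f differentiable (at p)"
    and step: "\<And>f v. P f \<Longrightarrow> P (dir_deriv v f)"
  shows "Cinf_on S f"
proof -
  have "P g \<Longrightarrow> Ck_on k S g" for k g
  proof (induction k arbitrary: g)
    case 0
    then show ?case
      by (auto intro!: continuous_at_imp_continuous_on differentiable_imp_continuous_within diff)
  next
    case (Suc k)
    then show ?case using diff step by auto
  qed
  then show ?thesis using P by (simp add: Cinf_on_def)
qed

text \<open>Product rule for the shape of \<open>heis_X\<close> and \<open>heis_Y\<close>: a linear
  coefficient \<open>c\<close> is its own derivative. The formula for \<open>g\<close> is assumed on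
  the open set \<open>S\<close> only, since the fields are known to have this shape only
  there.\<close>

lemma has_derivative_add_scaleR_linear:
  assumes "bounded_linear c" "Cinf_on S f" "Cinf_on S h" "open S" "p \<in> S"
    and eq: "\<And>q. q \<in> S \<Longrightarrow> g q = f q + c q *\<^sub>R h q"
  shows "(g has_derivative
           (\<lambda>v. dir_deriv v f p + (c v *\<^sub>R h p + c p *\<^sub>R dir_deriv v h p))) (at p)"
proof -
  have "((\<lambda>q. f q + c q *\<^sub>R h q) has_derivative
           (\<lambda>v. dir_deriv v f p + (c v *\<^sub>R h p + c p *\<^sub>R dir_deriv v h p))) (at p)"
    using has_derivative_add[OF Cinf_on_has_derivative[OF assms(2,5)]
        has_derivative_scaleR[OF bounded_linear_imp_has_derivative[OF assms(1)]
          Cinf_on_has_derivative[OF assms(3,5)]]]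
    by (simp add: add.commute)
  then show ?thesis
    by (rule has_derivative_transform_within_open[OF _ assms(4,5)]) (simp add: eq)
qed

lemma dir_deriv_add_scaleR_linear:
  assumes "bounded_linear c" "Cinf_on S f" "Cinf_on S h" "open S" "p \<in> S"
    and "\<And>q. q \<in> S \<Longrightarrow> g q = f q + c q *\<^sub>R h q"
  shows "dir_deriv v g p = dir_deriv v f p + (c v *\<^sub>R h p + c p *\<^sub>R dir_deriv v h p)"
  by (rule fun_cong[OF frechet_derivative_at[OF has_derivative_add_scaleR_linear[OF assms], symmetric]])

text \<open>The single pattern \<open>L (f q) + h q\<close> has several uses: \<open>L = 0\<close>
  gives locality, the identity gives sums, multiplication gives scaling, and \<open>of_real\<close>
  gives the passage to complex values.\<close>

lemma has_derivative_linear_add: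
  assumes "bounded_linear L" "Cinf_on S f" "Cinf_on S h" "open S" "p \<in> S"
    and eq: "\<And>q. q \<in> S \<Longrightarrow> g q = L (f q) + h q"
  shows "(g has_derivative (\<lambda>v. L (dir_deriv v f p) + dir_deriv v h p)) (at p)"
proof -
  have "((\<lambda>q. L (f q) + h q) has_derivative (\<lambda>v. L (dir_deriv v f p) + dir_deriv v h p)) (at p)"
    by (intro has_derivative_add bounded_linear.has_derivative[OF assms(1)]
        Cinf_on_has_derivative[OF assms(2,5)] Cinf_on_has_derivative[OF assms(3,5)])
  then show ?thesis
    by (rule has_derivative_transform_within_open[OF _ assms(4,5)]) (simp add: eq)
qed

lemma dir_deriv_linear_add:
  assumes "bounded_linear L" "Cinf_on S f" "Cinf_on S h" "open S" "p \<in> S"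
    and "\<And>q. q \<in> S \<Longrightarrow> g q = L (f q) + h q"
  shows "dir_deriv v g p = L (dir_deriv v f p) + dir_deriv v h p"
  by (rule fun_cong[OF frechet_derivative_at[OF has_derivative_linear_add[OF assms], symmetric]])

text \<open>Since \<open>L\<close> commutes with differentiation, the functions that agree on
  \<open>S\<close> with some \<open>L (f q) + h q\<close> form a class closed under
  \<open>dir_deriv\<close>.\<close>

lemma Cinf_on_linear_add:
  assumes "bounded_linear L" "open S" "Cinf_on S f" "Cinf_on S h"
    and "\<And>q. q \<in> S \<Longrightarrow> g q = L (f q) + h q"
  shows "Cinf_on S g"
proof -
  define P where "P g \<longleftrightarrow> (\<exists>f h. Cinf_on S f \<and> Cinf_on S h \<and> (\<forall>q\<in>S. g q = L (f q) + h q))" for g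
  show ?thesis
  proof (rule Cinf_on_coinduct[where P = P])
    show "P g"
      unfolding P_def by (rule exI[of _ f], rule exI[of _ h]) (simp add: assms(3-5))
  next
    fix g p assume "P g" "p \<in> S"
    then obtain f h where "Cinf_on S f" "Cinf_on S h" "\<And>q. q \<in> S \<Longrightarrow> g q = L (f q) + h q"
      unfolding P_def by blast
    from has_derivative_linear_add[OF assms(1) this(1,2) assms(2) \<open>p \<in> S\<close> this(3)]
    show "g differentiable (at p)"
      by (rule differentiableI)
  next
    fix g v assume "P g"
    then obtain f h where fh: "Cinf_on S f" "Cinf_on S h" "\<And>q. q \<in> S \<Longrightarrow> g q = L (f q) + h q"
      unfolding P_def by blast
    show "P (dir_deriv v g)"
      unfolding P_def
      by (rule exI[of _ "dir_deriv v f"], rule exI[of _ "dir_deriv v h"])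
        (intro conjI ballI Cinf_on_dir_deriv fh(1,2) dir_deriv_linear_add[OF assms(1) fh(1,2) assms(2) _ fh(3)])
  qed
qed

lemma Cinf_on_cong:
  assumes "open S" "Cinf_on S f" "\<And>q. q \<in> S \<Longrightarrow> f q = g q"
  shows "Cinf_on S g"
  by (rule Cinf_on_linear_add[OF bounded_linear_zero assms(1,2,2)]) (simp add: assms(3))

lemma Cinf_on_zero: "Cinf_on S (\<lambda>_. 0)"
  by (rule Cinf_on_coinduct[where P = "\<lambda>f. f = (\<lambda>_. 0)"]) auto

lemma Cinf_on_linear:
  assumes "bounded_linear L" "open S" "Cinf_on S f"
  shows "Cinf_on S (\<lambda>q. L (f q))"
  by (rule Cinf_on_linear_add[OF assms Cinf_on_zero]) simp

lemma Cinf_on_add: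
  assumes "open S" "Cinf_on S f" "Cinf_on S h"
  shows "Cinf_on S (\<lambda>q. f q + h q)"
  by (rule Cinf_on_linear_add[OF bounded_linear_ident assms]) simp

lemma dir_deriv_cong:
  assumes "open S" "Cinf_on S f" "p \<in> S" "\<And>q. q \<in> S \<Longrightarrow> f q = g q"
  shows "dir_deriv v f p = dir_deriv v g p"
  by (rule fun_cong[OF frechet_derivative_transform_within_open
        [OF Cinf_on_differentiable[OF assms(2,3)] assms(1,3,4)]])

lemma Cinf_on_add_scaleR_linear:
  fixes f g h :: "'a::real_normed_vector \<Rightarrow> 'b::real_normed_vector"
  assumes "bounded_linear c" "open S" "Cinf_on S f" "Cinf_on S h"
    and "\<And>q. q \<in> S \<Longrightarrow> g q = f q + c q *\<^sub>R h q"
  shows "Cinf_on S g"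
proof -
  define P where "P g \<longleftrightarrow> (\<exists>f h. Cinf_on S f \<and> Cinf_on S h \<and> (\<forall>q\<in>S. g q = f q + c q *\<^sub>R h q))"
    for g :: "'a \<Rightarrow> 'b"
  show ?thesis
  proof (rule Cinf_on_coinduct[where P = P])
    show "P g"
      unfolding P_def by (rule exI[of _ f], rule exI[of _ h]) (simp add: assms(3-5))
  next
    fix g p assume "P g" "p \<in> S"
    then obtain f h where "Cinf_on S f" "Cinf_on S h" "\<And>q. q \<in> S \<Longrightarrow> g q = f q + c q *\<^sub>R h q"
      unfolding P_def by blast
    from has_derivative_add_scaleR_linear[OF assms(1) this(1,2) assms(2) \<open>p \<in> S\<close> this(3)]
    show "g differentiable (at p)"
      by (rule differentiableI)
  next
    fix g v assume "P g"
    then obtain f h where fh: "Cinf_on S f" "Cinf_on S h" "\<And>q. q \<in> S \<Longrightarrow> g q = f q + c q *\<^sub>R h q"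
      unfolding P_def by blast
    \<comment> \<open>Regrouping keeps the derivative inside the class: \<open>c v\<close> is a
      constant, so the first bracket is smooth, and the rest is \<open>c\<close> times a smooth
      function.\<close>
    have "dir_deriv v g q = (dir_deriv v f q + c v *\<^sub>R h q) + c q *\<^sub>R dir_deriv v h q" if "q \<in> S" for q
      using dir_deriv_add_scaleR_linear[OF assms(1) fh(1,2) assms(2) that fh(3)] by (simp add: add.assoc)
    moreover have "Cinf_on S (\<lambda>q. dir_deriv v f q + c v *\<^sub>R h q)"
      by (rule Cinf_on_add[OF assms(2) Cinf_on_dir_deriv[OF fh(1)]
            Cinf_on_linear[OF bounded_linear_scaleR_right assms(2) fh(2)]])
    ultimately show "P (dir_deriv v g)"
      unfolding P_def using Cinf_on_dir_deriv[OF fh(2)]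
      by (intro exI[of _ "\<lambda>q. dir_deriv v f q + c v *\<^sub>R h q"] exI[of _ "dir_deriv v h"]) simp
  qed
qed

section \<open>Symmetry of second derivatives\<close>

text \<open>Chain rule along a line, at every parameter \<open>s\<close> and not only at 0, because
  the mean value theorem needs a whole interval.\<close>

lemma dir_deriv_along_line:
  assumes "f differentiable (at (p + s *\<^sub>R v))"
  shows "((\<lambda>s. f (p + s *\<^sub>R v)) has_vector_derivative dir_deriv v f (p + s *\<^sub>R v)) (at s)"
proof -
  have "(f has_derivative frechet_derivative f (at (p + s *\<^sub>R v))) (at (p + s *\<^sub>R v))"
    using assms frechet_derivative_works by blast
  moreover have "((\<lambda>s. p + s *\<^sub>R v) has_derivative (\<lambda>s. s *\<^sub>R v)) (at s)"
    by (auto intro!: derivative_eq_intros)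
  ultimately have "((\<lambda>s. f (p + s *\<^sub>R v)) has_derivative
      (\<lambda>t. frechet_derivative f (at (p + s *\<^sub>R v)) (t *\<^sub>R v))) (at s)"
    by (rule has_derivative_compose[rotated])
  then show ?thesis
    using linear_frechet_derivative[OF assms]
    by (simp add: has_vector_derivative_def linear_cmul)
qed

lemma second_difference_mvt:
  fixes f :: "'a::real_normed_vector \<Rightarrow> real"
  assumes "Cinf_on S f" "h > 0"
    and S: "\<And>a b. a \<in> {0..h} \<Longrightarrow> b \<in> {0..h} \<Longrightarrow> p + a *\<^sub>R v + b *\<^sub>R w \<in> S"
  obtains a b where "a \<in> {0..h}" "b \<in> {0..h}"
    "f (p + h *\<^sub>R v + h *\<^sub>R w) - f (p + h *\<^sub>R v) - f (p + h *\<^sub>R w) + f p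
       = h * h * dir_deriv w (dir_deriv v f) (p + a *\<^sub>R v + b *\<^sub>R w)"
proof -
  \<comment> \<open>\<open>\<phi>\<close> is the increment in direction \<open>w\<close> as a
    function of the displacement along \<open>v\<close>, so \<open>\<phi> h - \<phi> 0\<close> is
    the second difference. The mean value theorem is applied first along \<open>v\<close>, then
    along \<open>w\<close>.\<close>
  define \<phi> where "\<phi> s = f ((p + h *\<^sub>R w) + s *\<^sub>R v) - f (p + s *\<^sub>R v)" for s
  have "(\<phi> has_real_derivative
      dir_deriv v f ((p + h *\<^sub>R w) + s *\<^sub>R v) - dir_deriv v f (p + s *\<^sub>R v)) (at s)"
    if "0 \<le> s" "s \<le> h" for s
  proof -
    have "p + h *\<^sub>R w + s *\<^sub>R v \<in> S" "p + s *\<^sub>R v \<in> S"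
      using S[of s h] S[of s 0] that by (simp_all add: algebra_simps)
    then show ?thesis
      unfolding \<phi>_def has_real_derivative_iff_has_vector_derivative using assms(1)
      by (intro has_vector_derivative_diff dir_deriv_along_line Cinf_on_differentiable)
  qed
  from MVT2[OF \<open>h > 0\<close> this] obtain a where a: "0 < a" "a < h"
    "\<phi> h - \<phi> 0 = h * (dir_deriv v f ((p + h *\<^sub>R w) + a *\<^sub>R v) - dir_deriv v f (p + a *\<^sub>R v))"
    by auto
  have "((\<lambda>s. dir_deriv v f ((p + a *\<^sub>R v) + s *\<^sub>R w)) has_real_derivative
      dir_deriv w (dir_deriv v f) (p + a *\<^sub>R v + s *\<^sub>R w)) (at s)"
    if "0 \<le> s" "s \<le> h" for s
    unfolding has_real_derivative_iff_has_vector_derivative using assms(1) S[of a s] a that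
    by (intro dir_deriv_along_line Cinf_on_differentiable[OF Cinf_on_dir_deriv, where S = S]) auto
  from MVT2[OF \<open>h > 0\<close> this] obtain b where b: "0 < b" "b < h"
    "dir_deriv v f ((p + a *\<^sub>R v) + h *\<^sub>R w) - dir_deriv v f (p + a *\<^sub>R v)
      = h * dir_deriv w (dir_deriv v f) (p + a *\<^sub>R v + b *\<^sub>R w)"
    by auto
  show thesis
  proof (rule that[of a b])
    have swap: "p + h *\<^sub>R w + s *\<^sub>R v = p + s *\<^sub>R v + h *\<^sub>R w" for s
      by (simp add: ac_simps)
    show "f (p + h *\<^sub>R v + h *\<^sub>R w) - f (p + h *\<^sub>R v) - f (p + h *\<^sub>R w) + f p
       = h * h * dir_deriv w (dir_deriv v f) (p + a *\<^sub>R v + b *\<^sub>R w)"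
      using a(3) b(3) unfolding \<phi>_def swap by simp
  qed (use a b in auto)
qed

text \<open>The second difference is symmetric in \<open>v\<close> and \<open>w\<close>. Hence both
  mixed derivatives, each taken at some point near \<open>p\<close>, equal the same quotient by
  \<open>h * h\<close>, and continuity carries the equality to \<open>p\<close>.\<close>

lemma dir_deriv_commute:
  fixes f :: "'a::real_normed_vector \<Rightarrow> real"
  assumes "open S" "Cinf_on S f" "p \<in> S"
  shows "dir_deriv v (dir_deriv w f) p = dir_deriv w (dir_deriv v f) p"
proof -
  define A where "A = dir_deriv v (dir_deriv w f)"
  define B where "B = dir_deriv w (dir_deriv v f)"
  have "\<bar>A p - B p\<bar> \<le> e" if "e > 0" for e
  proof -
    have "isCont A p" "isCont B p"
      using assms Cinf_on_continuous Cinf_on_dir_deriv unfolding A_def B_def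
      by (metis continuous_on_eq_continuous_at)+
    then have "\<forall>\<^sub>F q in nhds p. \<bar>A q - A p\<bar> < e / 2" "\<forall>\<^sub>F q in nhds p. \<bar>B q - B p\<bar> < e / 2"
      using \<open>e > 0\<close> tendstoD[of A "A p" "nhds p" "e / 2"] tendstoD[of B "B p" "nhds p" "e / 2"]
      by (simp_all add: isCont_def tendsto_at_iff_tendsto_nhds dist_real_def)
    moreover have "\<forall>\<^sub>F q in nhds p. q \<in> S"
      using assms eventually_nhds by blast
    ultimately have "\<forall>\<^sub>F q in nhds p. \<bar>A q - A p\<bar> < e / 2 \<and> \<bar>B q - B p\<bar> < e / 2 \<and> q \<in> S"
      by eventually_elim auto
    then obtain d where d: "d > 0"
      "\<And>q. dist q p < d \<Longrightarrow> \<bar>A q - A p\<bar> < e / 2 \<and> \<bar>B q - B p\<bar> < e / 2 \<and> q \<in> S"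
      unfolding eventually_nhds_metric by blast
    \<comment> \<open>This makes the parallelogram spanned by \<open>h *\<^sub>R v\<close> and
      \<open>h *\<^sub>R w\<close> at \<open>p\<close> lie in the ball of radius \<open>d\<close>.
      The summand 1 keeps the denominator positive when both vectors vanish.\<close>
    define h where "h = d / (norm v + norm w + 1)"
    have pos: "norm v + norm w + 1 > 0"
      by (smt (verit) norm_ge_zero)
    have h: "h > 0" "h * (norm v + norm w) < d"
      using pos d(1) by (simp_all add: h_def field_simps)
    have near: "dist (p + a *\<^sub>R v + b *\<^sub>R w) p < d" if "a \<in> {0..h}" "b \<in> {0..h}" for a b
    proof -
      have "norm (a *\<^sub>R v + b *\<^sub>R w) \<le> a * norm v + b * norm w"
        using that norm_triangle_ineq[of "a *\<^sub>R v" "b *\<^sub>R w"] by simp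
      also have "\<dots> \<le> h * norm v + h * norm w"
        using that by (intro add_mono mult_right_mono) auto
      finally show ?thesis
        using h by (simp add: dist_norm algebra_simps)
    qed
    from d(2)[OF near] have "p + a *\<^sub>R v + b *\<^sub>R w \<in> S" if "a \<in> {0..h}" "b \<in> {0..h}" for a b
      using that by blast
    from second_difference_mvt[OF assms(2) h(1) this] obtain a b where ab:
      "a \<in> {0..h}" "b \<in> {0..h}"
      "f (p + h *\<^sub>R v + h *\<^sub>R w) - f (p + h *\<^sub>R v) - f (p + h *\<^sub>R w) + f p
        = h * h * B (p + a *\<^sub>R v + b *\<^sub>R w)"
      unfolding B_def by metis
    have near': "dist (p + a *\<^sub>R w + b *\<^sub>R v) p < d" if "a \<in> {0..h}" "b \<in> {0..h}" for a b
      using near[OF that(2,1)] by (simp add: ac_simps)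
    from d(2)[OF near'] have "p + a *\<^sub>R w + b *\<^sub>R v \<in> S" if "a \<in> {0..h}" "b \<in> {0..h}" for a b
      using that by blast
    \<comment> \<open>The same estimate with \<open>v\<close> and \<open>w\<close> exchanged
      produces \<open>A\<close> in place of \<open>B\<close>.\<close>
    from second_difference_mvt[OF assms(2) h(1) this] obtain a' b' where ab':
      "a' \<in> {0..h}" "b' \<in> {0..h}"
      "f (p + h *\<^sub>R w + h *\<^sub>R v) - f (p + h *\<^sub>R w) - f (p + h *\<^sub>R v) + f p
        = h * h * A (p + a' *\<^sub>R w + b' *\<^sub>R v)"
      unfolding A_def by metis
    have swap: "p + h *\<^sub>R w + h *\<^sub>R v = p + h *\<^sub>R v + h *\<^sub>R w"
      by (simp add: ac_simps)
    have "h * h * A (p + a' *\<^sub>R w + b' *\<^sub>R v) = h * h * B (p + a *\<^sub>R v + b *\<^sub>R w)"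
      using ab(3) ab'(3) unfolding swap by linarith
    then have "A (p + a' *\<^sub>R w + b' *\<^sub>R v) = B (p + a *\<^sub>R v + b *\<^sub>R w)"
      using h(1) by (metis mult_cancel_left mult_eq_0_iff less_irrefl)
    then show ?thesis
      using d(2)[OF near[OF ab(1,2)]] d(2)[OF near'[OF ab'(1,2)]] by argo
  qed
  then have "A p = B p"
    by (metis abs_le_zero_iff dense_ge eq_iff_diff_eq_0)
  then show ?thesis by (simp add: A_def B_def)
qed

section \<open>The left-invariant fields\<close>

text \<open>The coefficients of the fields are linear in the point. The sign in
  \<open>heis_Y\<close> is moved into its coefficient so that both fields fit the same product
  rule.\<close>

lemma bounded_linear_coordinates:
  "bounded_linear (\<lambda>p::heis. 2 * Im (fst p))" "bounded_linear (\<lambda>p::heis. - 2 * Re (fst p))"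
  by (intro bounded_linear_const_mult bounded_linear_compose[OF bounded_linear_Im]
      bounded_linear_compose[OF bounded_linear_Re] bounded_linear_fst)+

lemma vector_derivative_line:
  assumes "g differentiable (at p)"
  shows "vector_derivative (\<lambda>s. g (p + s *\<^sub>R v)) (at 0) = dir_deriv v g p"
  using dir_deriv_along_line[of g p 0 v] assms by (simp add: vector_derivative_at)

text \<open>At a point of differentiability the partial derivatives are values of the Frechet
  derivative on the real basis \<open>(1, 0)\<close>, \<open>(\<i>, 0)\<close>,
  \<open>(0, 1)\<close>.\<close>

lemma heis_fields_eq_dir_deriv:
  assumes "g differentiable (at p)"
  shows "heis_T g p = dir_deriv (0, 1) g p"
    and "heis_X g p = dir_deriv (1, 0) g p + (2 * Im (fst p)) *\<^sub>R dir_deriv (0, 1) g p"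
    and "heis_Y g p = dir_deriv (\<i>, 0) g p + (- 2 * Re (fst p)) *\<^sub>R dir_deriv (0, 1) g p"
proof -
  have line: "(fst p, snd p + s) = p + s *\<^sub>R (0, 1)" "(fst p + of_real s, snd p) = p + s *\<^sub>R (1, 0)"
    "(fst p + \<i> * of_real s, snd p) = p + s *\<^sub>R (\<i>, 0)" for s
    by (simp_all add: prod_eq_iff scaleR_conv_of_real)
  show "heis_T g p = dir_deriv (0, 1) g p"
    "heis_X g p = dir_deriv (1, 0) g p + (2 * Im (fst p)) *\<^sub>R dir_deriv (0, 1) g p"
    "heis_Y g p = dir_deriv (\<i>, 0) g p + (- 2 * Re (fst p)) *\<^sub>R dir_deriv (0, 1) g p"
    unfolding heis_T_def heis_X_def heis_Y_def partial_x_def partial_y_def partial_t_def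
      line vector_derivative_line[OF assms] by simp_all
qed

lemmas heis_fields_Cinf_on = heis_fields_eq_dir_deriv[OF Cinf_on_differentiable]

lemma Cinf_on_heis_fields:
  assumes "open S" "Cinf_on S g"
  shows "Cinf_on S (heis_X g)" "Cinf_on S (heis_Y g)" "Cinf_on S (heis_T g)"
  using Cinf_on_add_scaleR_linear[OF bounded_linear_coordinates(1) assms(1)
        Cinf_on_dir_deriv[OF assms(2)] Cinf_on_dir_deriv[OF assms(2)] heis_fields_Cinf_on(2)[OF assms(2)]]
    Cinf_on_add_scaleR_linear[OF bounded_linear_coordinates(2) assms(1)
        Cinf_on_dir_deriv[OF assms(2)] Cinf_on_dir_deriv[OF assms(2)] heis_fields_Cinf_on(3)[OF assms(2)]]
    Cinf_on_cong[OF assms(1) Cinf_on_dir_deriv[OF assms(2)] heis_fields_Cinf_on(1)[OF assms(2), symmetric]]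
  by blast+

section \<open>Locality and linearity of the fields and the Laplacian\<close>

lemma heis_fields_cong:
  assumes "open S" "Cinf_on S f" "p \<in> S" "\<And>q. q \<in> S \<Longrightarrow> f q = g q"
  shows "heis_X f p = heis_X g p" "heis_Y f p = heis_Y g p" "heis_T f p = heis_T g p"
  using dir_deriv_cong[OF assms]
  by (simp_all add: heis_fields_Cinf_on[OF assms(2,3)]
      heis_fields_Cinf_on[OF Cinf_on_cong[OF assms(1,2,4)] assms(3)])

lemma heis_fields_linear_add:
  assumes "bounded_linear L" "open S" "Cinf_on S f" "Cinf_on S h" "p \<in> S"
    and "\<And>q. q \<in> S \<Longrightarrow> g q = L (f q) + h q"
  shows "heis_X g p = L (heis_X f p) + heis_X h p"
    "heis_Y g p = L (heis_Y f p) + heis_Y h p"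
    "heis_T g p = L (heis_T f p) + heis_T h p"
proof -
  interpret bounded_linear L by fact
  note d = dir_deriv_linear_add[OF assms(1,3,4,2,5,6)]
  have "Cinf_on S g" by (rule Cinf_on_linear_add[OF assms(1-4,6)])
  from heis_fields_Cinf_on[OF this assms(5)] show
    "heis_X g p = L (heis_X f p) + heis_X h p"
    "heis_Y g p = L (heis_Y f p) + heis_Y h p"
    "heis_T g p = L (heis_T f p) + heis_T h p"
    by (simp_all add: d heis_fields_Cinf_on[OF assms(3,5)] heis_fields_Cinf_on[OF assms(4,5)]
        add diff scaleR algebra_simps)
qed

lemma heis_laplacian_linear_add:
  assumes "bounded_linear L" "open S" "Cinf_on S f" "Cinf_on S h" "p \<in> S"
    and "\<And>q. q \<in> S \<Longrightarrow> g q = L (f q) + h q"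
  shows "heis_laplacian g p = L (heis_laplacian f p) + heis_laplacian h p"
proof -
  interpret bounded_linear L by fact
  note * = heis_fields_linear_add[OF assms(1,2)]
  note c = Cinf_on_heis_fields[OF assms(2)]
  \<comment> \<open>The first-order identity holds at every point of \<open>S\<close>, so it serves
    as the hypothesis for its own second application.\<close>
  have "heis_X (heis_X g) p = L (heis_X (heis_X f) p) + heis_X (heis_X h) p"
    by (rule *(1)[OF c(1) c(1) _ *(1)]) (use assms in auto)
  moreover have "heis_Y (heis_Y g) p = L (heis_Y (heis_Y f) p) + heis_Y (heis_Y h) p"
    by (rule *(2)[OF c(2) c(2) _ *(2)]) (use assms in auto)
  ultimately show ?thesis
    by (simp add: heis_laplacian_def add)
qed

lemma heis_laplacian_cong:
  assumes "open S" "Cinf_on S f" "p \<in> S" "\<And>q. q \<in> S \<Longrightarrow> f q = g q"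
  shows "heis_laplacian f p = heis_laplacian g p"
  using heis_laplacian_linear_add[OF bounded_linear_zero assms(1,2,2,3), of g] assms(4) by simp

lemma heis_T_laplacian_scale:
  fixes f g :: "heis \<Rightarrow> real"
  assumes "open S" "Cinf_on S f" "p \<in> S" "\<And>q. q \<in> S \<Longrightarrow> g q = c * f q"
  shows "heis_T g p = c * heis_T f p" "heis_laplacian g p = c * heis_laplacian f p"
proof -
  \<comment> \<open>Splitting \<open>c\<close> as \<open>(c - 1) + 1\<close> brings the multiple
    into the form \<open>L (f q) + h q\<close> with \<open>h = f\<close>.\<close>
  have eq: "g q = (c - 1) * f q + f q" if "q \<in> S" for q
    using assms(4)[OF that] by (simp add: algebra_simps)
  show "heis_T g p = c * heis_T f p" "heis_laplacian g p = c * heis_laplacian f p"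
    using heis_fields_linear_add(3)[OF bounded_linear_mult_right assms(1,2,2,3) eq]
      heis_laplacian_linear_add[OF bounded_linear_mult_right assms(1,2,2,3) eq]
    by (simp_all add: algebra_simps)
qed

section \<open>Commutation relations among X, Y and T\<close>

lemma heis_T_commute:
  fixes u :: "heis \<Rightarrow> real"
  assumes "open S" "Cinf_on S u" "p \<in> S"
  shows "heis_X (heis_T u) p = heis_T (heis_X u) p"
    and "heis_Y (heis_T u) p = heis_T (heis_Y u) p"
proof -
  note D = Cinf_on_dir_deriv[OF assms(2)]
  note T = dir_deriv_cong[OF assms(1) Cinf_on_heis_fields(3)[OF assms(1,2)] assms(3) heis_fields_Cinf_on(1)[OF assms(2)]]
  \<comment> \<open>The coefficients of X and Y vanish on \<open>(0, 1)\<close>, that is, they do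
    not depend on t. So the product rule leaves no extra term under T, and symmetry of second
    derivatives finishes.\<close>
  note X = dir_deriv_add_scaleR_linear[OF bounded_linear_coordinates(1) D D assms(1,3) heis_fields_Cinf_on(2)[OF assms(2)]]
  note Y = dir_deriv_add_scaleR_linear[OF bounded_linear_coordinates(2) D D assms(1,3) heis_fields_Cinf_on(3)[OF assms(2)]]
  note C = dir_deriv_commute[OF assms]
  show "heis_X (heis_T u) p = heis_T (heis_X u) p"
    using heis_fields_Cinf_on[OF Cinf_on_heis_fields(3)[OF assms(1,2)] assms(3)]
      heis_fields_Cinf_on[OF Cinf_on_heis_fields(1)[OF assms(1,2)] assms(3)]
      C[of "(1, 0)" "(0, 1)"]
    by (simp add: T X)
  show "heis_Y (heis_T u) p = heis_T (heis_Y u) p"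
    using heis_fields_Cinf_on[OF Cinf_on_heis_fields(3)[OF assms(1,2)] assms(3)]
      heis_fields_Cinf_on[OF Cinf_on_heis_fields(2)[OF assms(1,2)] assms(3)]
      C[of "(\<i>, 0)" "(0, 1)"]
    by (simp add: T Y)
qed

text \<open>Second-order terms cancel by symmetry. What remains is the derivative of the
  coefficients: Y(2y) = 2 and X(-2x) = -2, whose difference is the factor 4. The sum form matches
  \<open>L (f q) + h q\<close>, so a further field can be applied to it.\<close>

lemma heis_Y_X_commutator:
  fixes u :: "heis \<Rightarrow> real"
  assumes "open S" "Cinf_on S u" "p \<in> S"
  shows "heis_Y (heis_X u) p = 4 * heis_T u p + heis_X (heis_Y u) p"
proof -
  note D = Cinf_on_dir_deriv[OF assms(2)]
  note X = dir_deriv_add_scaleR_linear[OF bounded_linear_coordinates(1) D D assms(1,3) heis_fields_Cinf_on(2)[OF assms(2)]]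
  note Y = dir_deriv_add_scaleR_linear[OF bounded_linear_coordinates(2) D D assms(1,3) heis_fields_Cinf_on(3)[OF assms(2)]]
  note C = dir_deriv_commute[OF assms]
  show ?thesis
    using heis_fields_Cinf_on(2)[OF Cinf_on_heis_fields(2)[OF assms(1,2)] assms(3)]
      heis_fields_Cinf_on(3)[OF Cinf_on_heis_fields(1)[OF assms(1,2)] assms(3)]
      heis_fields_Cinf_on(1)[OF assms(2,3)]
      C[of "(\<i>, 0)" "(0, 1)"] C[of "(1, 0)" "(0, 1)"] C[of "(1, 0)" "(\<i>, 0)"]
    by (simp add: X Y algebra_simps)
qed

section \<open>Commuting the fields with the Laplacian\<close>

lemma Cinf_on_heis_laplacian: "open S \<Longrightarrow> Cinf_on S g \<Longrightarrow> Cinf_on S (heis_laplacian g)"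
  by (rule Cinf_on_cong[OF _ Cinf_on_add[of S "heis_X (heis_X g)" "heis_Y (heis_Y g)"]])
     (auto intro: Cinf_on_heis_fields simp: heis_laplacian_def)

lemma heis_fields_laplacian:
  assumes "open S" "Cinf_on S g" "p \<in> S"
  shows "heis_X (heis_laplacian g) p = heis_X (heis_X (heis_X g)) p + heis_X (heis_Y (heis_Y g)) p"
    "heis_Y (heis_laplacian g) p = heis_Y (heis_X (heis_X g)) p + heis_Y (heis_Y (heis_Y g)) p"
    "heis_T (heis_laplacian g) p = heis_T (heis_X (heis_X g)) p + heis_T (heis_Y (heis_Y g)) p"
  by (rule heis_fields_linear_add[OF bounded_linear_ident assms(1)
        Cinf_on_heis_fields(1)[OF assms(1) Cinf_on_heis_fields(1)[OF assms(1,2)]]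
        Cinf_on_heis_fields(2)[OF assms(1) Cinf_on_heis_fields(2)[OF assms(1,2)]]
        assms(3) heis_laplacian_def])+

text \<open>Only the summand Y^2 fails to commute with X. Moving X to the left past each Y costs one
  commutator: YYX = 4YT + YXY = 4YT + 4TY + XYY, and YT = TY.\<close>

lemma heis_laplacian_X:
  fixes u :: "heis \<Rightarrow> real"
  assumes "open S" "Cinf_on S u" "p \<in> S"
  shows "heis_laplacian (heis_X u) p = heis_X (heis_laplacian u) p + 8 * heis_T (heis_Y u) p"
proof -
  note c = Cinf_on_heis_fields[OF assms(1)]
  have "heis_Y (heis_Y (heis_X u)) p = 4 * heis_Y (heis_T u) p + heis_Y (heis_X (heis_Y u)) p"
    by (rule heis_fields_linear_add(2)[OF bounded_linear_mult_right assms(1) c(3)[OF assms(2)]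
          c(1)[OF c(2)[OF assms(2)]] assms(3)])
      (rule heis_Y_X_commutator[OF assms(1,2)])
  also have "heis_Y (heis_X (heis_Y u)) p = 4 * heis_T (heis_Y u) p + heis_X (heis_Y (heis_Y u)) p"
    by (rule heis_Y_X_commutator[OF assms(1) c(2)[OF assms(2)] assms(3)])
  finally show ?thesis
    using heis_T_commute[OF assms] heis_fields_laplacian[OF assms]
    by (simp add: heis_laplacian_def)
qed

text \<open>Here X^2 is the summand that matters: XXY = -4XT + XYX = -4XT - 4TX + YXX, and XT =
  TX.\<close>

lemma heis_laplacian_Y:
  fixes u :: "heis \<Rightarrow> real"
  assumes "open S" "Cinf_on S u" "p \<in> S"
  shows "heis_laplacian (heis_Y u) p = heis_Y (heis_laplacian u) p - 8 * heis_T (heis_X u) p"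
proof -
  note c = Cinf_on_heis_fields[OF assms(1)]
  have "heis_X (heis_X (heis_Y u)) p = - 4 * heis_X (heis_T u) p + heis_X (heis_Y (heis_X u)) p"
    by (rule heis_fields_linear_add(1)[OF bounded_linear_mult_right assms(1) c(3)[OF assms(2)]
          c(2)[OF c(1)[OF assms(2)]] assms(3)])
      (simp add: heis_Y_X_commutator[OF assms(1,2)])
  also have "heis_X (heis_Y (heis_X u)) p = heis_Y (heis_X (heis_X u)) p - 4 * heis_T (heis_X u) p"
    using heis_Y_X_commutator[OF assms(1) c(1)[OF assms(2)] assms(3)] by simp
  finally show ?thesis
    using heis_T_commute[OF assms] heis_fields_laplacian[OF assms]
    by (simp add: heis_laplacian_def)
qed

lemma heis_laplacian_T:
  fixes u :: "heis \<Rightarrow> real"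
  assumes "open S" "Cinf_on S u" "p \<in> S"
  shows "heis_laplacian (heis_T u) p = heis_T (heis_laplacian u) p"
proof -
  note c = Cinf_on_heis_fields[OF assms(1)]
  have "heis_X (heis_X (heis_T u)) p = heis_X (heis_T (heis_X u)) p"
    by (rule heis_fields_cong(1)[OF assms(1) c(1)[OF c(3)[OF assms(2)]] assms(3)
          heis_T_commute(1)[OF assms(1,2)]])
  moreover have "heis_Y (heis_Y (heis_T u)) p = heis_Y (heis_T (heis_Y u)) p"
    by (rule heis_fields_cong(2)[OF assms(1) c(2)[OF c(3)[OF assms(2)]] assms(3)
          heis_T_commute(2)[OF assms(1,2)]])
  ultimately show ?thesis
    using heis_T_commute(1)[OF assms(1) c(1)[OF assms(2)] assms(3)]
      heis_T_commute(2)[OF assms(1) c(2)[OF assms(2)] assms(3)] heis_fields_laplacian[OF assms]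
    by (simp add: heis_laplacian_def)
qed

section \<open>The systems for a gradient harmonic map\<close>

theorem proposition7p9:
  fixes \<Omega> :: "heis set" and u :: "heis \<Rightarrow> real" and f :: "heis \<Rightarrow> heis"
    and f1 f2 f3 :: "heis \<Rightarrow> real" and F :: "heis \<Rightarrow> complex"
  assumes "open \<Omega>" and "connected \<Omega>" and "\<Omega> \<noteq> {}"
    and "heis_harmonic_on \<Omega> u"
    and "gradient_harmonic_map_on \<Omega> u f"
    and "f1 = (\<lambda>p. Re (fst (f p)))"
    and "f2 = (\<lambda>p. Im (fst (f p)))"
    and "f3 = (\<lambda>p. snd (f p))"
    and "F = (\<lambda>p. of_real (f1 p) + \<i> * of_real (f2 p))"
  shows "(\<forall>p\<in>\<Omega>. heis_laplacian f1 p = 8 * heis_T f2 p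
            \<and> heis_laplacian f2 p = - 8 * heis_T f1 p
            \<and> heis_laplacian f3 p = 0)
       \<and> (\<forall>p\<in>\<Omega>. heis_laplacian F p = - 8 * \<i> * heis_T F p)
       \<and> (\<forall>p\<in>\<Omega>. heis_laplacian (heis_laplacian f1) p = - 64 * heis_T (heis_T f1) p
            \<and> heis_laplacian (heis_laplacian f2) p = - 64 * heis_T (heis_T f2) p
            \<and> heis_laplacian f3 p = 0)"
proof -
  have "Cinf_on \<Omega> u" and harm: "\<And>p. p \<in> \<Omega> \<Longrightarrow> heis_laplacian u p = 0"
    using assms(4) by (auto simp: heis_harmonic_on_def)
  note u = \<open>open \<Omega>\<close> \<open>Cinf_on \<Omega> u\<close>
  have eq: "heis_X u q = f1 q" "heis_Y u q = f2 q" "heis_T u q = f3 q" if "q \<in> \<Omega>" for q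
    using assms(5-8) that by (auto simp: gradient_harmonic_map_on_def)
  note smooth_fields = Cinf_on_heis_fields[OF u]
  have smooth: "Cinf_on \<Omega> f1" "Cinf_on \<Omega> f2"
    using Cinf_on_cong[OF u(1)] smooth_fields eq by blast+
  \<comment> \<open>The Laplacian of \<open>u\<close> vanishes only on \<Omega>, so locality is used
    to compare it with the constant function 0.\<close>
  have fields_lap: "heis_X (heis_laplacian u) p = 0" "heis_Y (heis_laplacian u) p = 0"
    "heis_T (heis_laplacian u) p = 0" if "p \<in> \<Omega>" for p
    using heis_fields_cong[OF u(1) Cinf_on_heis_laplacian[OF u] that, of "\<lambda>_. 0"] harm
    by (auto simp: heis_fields_eq_dir_deriv)
  have lap1: "heis_laplacian f1 p = 8 * heis_T f2 p" if "p \<in> \<Omega>" for p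
    using heis_laplacian_X[OF u that] fields_lap[OF that]
      heis_laplacian_cong[OF u(1) smooth_fields(1) that eq(1)]
      heis_fields_cong(3)[OF u(1) smooth_fields(2) that eq(2)] by simp
  have lap2: "heis_laplacian f2 p = - 8 * heis_T f1 p" if "p \<in> \<Omega>" for p
    using heis_laplacian_Y[OF u that] fields_lap[OF that]
      heis_laplacian_cong[OF u(1) smooth_fields(2) that eq(2)]
      heis_fields_cong(3)[OF u(1) smooth_fields(1) that eq(1)] by simp
  have lap3: "heis_laplacian f3 p = 0" if "p \<in> \<Omega>" for p
    using heis_laplacian_T[OF u that] fields_lap[OF that]
      heis_laplacian_cong[OF u(1) smooth_fields(3) that eq(3)] by simp
  have lapF: "heis_laplacian F p = - 8 * \<i> * heis_T F p" if "p \<in> \<Omega>" for p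
  proof -
    \<comment> \<open>\<open>F\<close> is split in two stages: \<open>of_real\<close> applied to
      \<open>f1\<close> plus the function i \<open>f2\<close>, and the latter as
      \<open>L (f2 q) + 0\<close> with this \<open>L\<close>.\<close>
    have iL: "bounded_linear (\<lambda>x. \<i> * complex_of_real x)"
      by (intro bounded_linear_const_mult bounded_linear_of_real)
    have smooth_i: "Cinf_on \<Omega> (\<lambda>p. \<i> * complex_of_real (f2 p))"
      by (rule Cinf_on_linear[OF iL u(1) smooth(2)])
    have i: "\<i> * complex_of_real (f2 q) = \<i> * complex_of_real (f2 q) + 0" for q
      by simp
    \<comment> \<open>Additivity applied to 0 = 0 + 0 forces both values to be zero.\<close>
    have "heis_T (\<lambda>_. 0 :: complex) p = 0" "heis_laplacian (\<lambda>_. 0 :: complex) p = 0"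
      using heis_fields_linear_add(3)[OF bounded_linear_ident u(1) Cinf_on_zero Cinf_on_zero that, of "\<lambda>_. 0"]
        heis_laplacian_linear_add[OF bounded_linear_ident u(1) Cinf_on_zero Cinf_on_zero that, of "\<lambda>_. 0"]
      by simp_all
    then have "heis_T (\<lambda>p. \<i> * complex_of_real (f2 p)) p = \<i> * of_real (heis_T f2 p)"
      "heis_laplacian (\<lambda>p. \<i> * complex_of_real (f2 p)) p = \<i> * of_real (heis_laplacian f2 p)"
      using heis_fields_linear_add(3)[OF iL u(1) smooth(2) Cinf_on_zero that i]
        heis_laplacian_linear_add[OF iL u(1) smooth(2) Cinf_on_zero that i]
      by simp_all
    then have "heis_T F p = of_real (heis_T f1 p) + \<i> * of_real (heis_T f2 p)"
      "heis_laplacian F p = of_real (heis_laplacian f1 p) + \<i> * of_real (heis_laplacian f2 p)"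
      using heis_fields_linear_add(3)[OF bounded_linear_of_real u(1) smooth(1) smooth_i that, of F]
        heis_laplacian_linear_add[OF bounded_linear_of_real u(1) smooth(1) smooth_i that, of F] assms(9)
      by simp_all
    \<comment> \<open>By the first system the Laplacian is 8 T f2 - 8i T f1, which is -8i (T f1 + i
      T f2).\<close>
    then show ?thesis
      using lap1[OF that] lap2[OF that] by (simp add: algebra_simps)
  qed
  \<comment> \<open>With D for the Laplacian: D D f1 = 8 D T f2 = 8 T D f2 = 8 T (-8 T f1). The
    outer operators may be applied because \<open>lap1\<close> and \<open>lap2\<close> hold on all
    of the open set \<Omega>.\<close>
  have laplap1: "heis_laplacian (heis_laplacian f1) p = - 64 * heis_T (heis_T f1) p" if "p \<in> \<Omega>" for p
    using heis_T_laplacian_scale(2)[OF u(1) Cinf_on_heis_fields(3)[OF u(1) smooth(2)] that lap1]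
      heis_laplacian_T[OF u(1) smooth(2) that]
      heis_T_laplacian_scale(1)[OF u(1) Cinf_on_heis_fields(3)[OF u(1) smooth(1)] that lap2]
    by simp
  have laplap2: "heis_laplacian (heis_laplacian f2) p = - 64 * heis_T (heis_T f2) p" if "p \<in> \<Omega>" for p
    using heis_T_laplacian_scale(2)[OF u(1) Cinf_on_heis_fields(3)[OF u(1) smooth(1)] that lap2]
      heis_laplacian_T[OF u(1) smooth(1) that]
      heis_T_laplacian_scale(1)[OF u(1) Cinf_on_heis_fields(3)[OF u(1) smooth(2)] that lap1]
    by simp
  show ?thesis
    using lap1 lap2 lap3 lapF laplap1 laplap2 by blast
qed

end
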